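(* Let $r\ge 1$ and let $\chi_1,\ldots,\chi_r$ be non-principal Dirichlet characters modulo $q_1,\ldots,q_r$ respectively. For complex $s_1,\ldots,s_r$ with $\sigma_i=\Re(s_i)$, consider the iterated multiple series $$L(s_1,\ldots,s_r;\chi_1,\ldots,\chi_r)=\sum_{n_1=1}^{\infty}\sum_{n_2=1}^{\infty}\cdots\sum_{n_r=1}^{\infty}\frac{\chi_1(n_1)\chi_2(n_2)\cdots\chi_r(n_r)}{n_1^{s_1}(n_1+n_2)^{s_2}\cdots(n_1+n_2+\cdots+n_r)^{s_r}},$$ where the summation is performed first over $n_r$, then over $n_{r-1}$, and so on, finally over $n_1$. Then this series is (conditionally) convergent for all $(s_1,\ldots,s_r)$ in the region $$\mathcal{D}=\{(s_1,\ldots,s_r)\in\mathbb{C}^r:\ \sigma_r+\sigma_{r-1}+\cdots+\sigma_{r-i}>0\ \text{ for }0\le i\le r-1\}.$$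
   Context: Powers $a^{s}$ with $a>0$ real denote $e^{s\log a}$ with the real logarithm. Convergence of the iterated series means each inner sum converges and the successive outer sums converge, in the order stated. *)

theory Defs
  imports "HOL-Analysis.Analysis"
begin

definition dirichlet_character :: "nat \<Rightarrow> (nat \<Rightarrow> complex) \<Rightarrow> bool" where
  "dirichlet_character q chi \<longleftrightarrow>
     q > 0 \<and>
     (\<forall>m n. chi (m * n) = chi m * chi n) \<and>
     (\<forall>n. chi (n + q) = chi n) \<and>
     (\<forall>n. chi n \<noteq> 0 \<longleftrightarrow> coprime n q)"

definition principal_character :: "nat \<Rightarrow> nat \<Rightarrow> complex" where
  "principal_character q n = (if coprime n q then 1 else 0)"

text \<open>
  The iterated series of a function of \<open>r\<close> positive integers, given as a list
  \<open>[n\<^sub>1, \<dots>, n\<^sub>r]\<close>.  The head of the list is the outermost summation variable, so that the sum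
  over \<open>n\<^sub>r\<close> is taken first and the sum over \<open>n\<^sub>1\<close> last.
\<close>

fun iterated_suminf :: "nat \<Rightarrow> (nat list \<Rightarrow> complex) \<Rightarrow> complex" where
  "iterated_suminf 0 f = f []"
| "iterated_suminf (Suc k) f = (\<Sum>m. iterated_suminf k (\<lambda>ns. f (Suc m # ns)))"

text \<open>
  Since \<^const>\<open>suminf\<close> is total, convergence at every level, for all values of the outer
  variables, has to be demanded separately.
\<close>

fun iterated_summable :: "nat \<Rightarrow> (nat list \<Rightarrow> complex) \<Rightarrow> bool" where
  "iterated_summable 0 f \<longleftrightarrow> True"
| "iterated_summable (Suc k) f \<longleftrightarrow>
     (\<forall>m. iterated_summable k (\<lambda>ns. f (Suc m # ns))) \<and>
     summable (\<lambda>m. iterated_suminf k (\<lambda>ns. f (Suc m # ns)))"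

text \<open>
  Indices run from \<open>0\<close> to \<open>r - 1\<close>: \<open>chi i\<close>, \<open>s i\<close> and \<open>ns ! i\<close> are the \<open>(i + 1)\<close>-st character,
  exponent and summation variable.
\<close>

definition multiple_L_term ::
  "nat \<Rightarrow> (nat \<Rightarrow> complex) \<Rightarrow> (nat \<Rightarrow> nat \<Rightarrow> complex) \<Rightarrow> nat list \<Rightarrow> complex" where
  "multiple_L_term r s chi ns =
     (\<Prod>i<r. chi i (ns ! i)) / (\<Prod>i<r. of_nat (\<Sum>j\<le>i. ns ! j) powr s i)"

text \<open>The complex power above is the one formed with the real logarithm of the base.\<close>

lemma of_nat_powr_eq_exp_ln:
  assumes "n > 0"
  shows "(of_nat n :: complex) powr z = exp (z * of_real (ln (real n)))"
  using assms by (simp add: powr_def flip: Ln_of_nat)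

definition multiple_L_convergent ::
  "nat \<Rightarrow> (nat \<Rightarrow> complex) \<Rightarrow> (nat \<Rightarrow> nat \<Rightarrow> complex) \<Rightarrow> bool" where
  "multiple_L_convergent r s chi \<longleftrightarrow> iterated_summable r (multiple_L_term r s chi)"

text \<open>Only the values \<open>s 0, \<dots>, s (r - 1)\<close> matter; they represent a point of \<open>\<complex>\<^sup>r\<close>.\<close>

definition convergence_region :: "nat \<Rightarrow> (nat \<Rightarrow> complex) set" where
  "convergence_region r = {s. \<forall>i\<le>r - 1. (\<Sum>j = r - 1 - i..r - 1. Re (s j)) > 0}"

end

theory Submission
  imports Defs "HOL-Number_Theory.Cong" "HOL-Real_Asymp.Real_Asymp"
begin

text \<open>
  Call \<open>g\<close> a symbol of order \<open>a\<close> if its \<open>i\<close>-th finite difference is \<open>O(n powr (a - i))\<close> for all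
  \<open>i\<close>. Symbols are closed under products, the orders being added, and \<open>n powr z\<close> is a symbol of
  order \<open>Re z\<close>. A non-principal character \<open>\<chi>\<close> has bounded partial sums, so for a symbol \<open>g\<close> of
  negative order \<open>a\<close> partial summation shows that \<open>G x = (\<Sum>n\<ge>1. \<chi> n * g (x + n))\<close> converges and
  is \<open>O(x powr a)\<close>; as \<open>g \<mapsto> G\<close> commutes with differences, \<open>G\<close> is again a symbol of order \<open>a\<close>.
  Carrying out the sums from the inside outwards, the sum over \<open>n\<^sub>k, \<dots>, n\<^sub>r\<close> is therefore a symbol
  of order \<open>- (\<sigma>\<^sub>k + \<dots> + \<sigma>\<^sub>r) < 0\<close> in \<open>n\<^sub>1 + \<dots> + n\<^sub>k\<^sub>-\<^sub>1\<close>.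
\<close>

section \<open>Sequences of symbol type\<close>

definition diff_seq :: "(nat \<Rightarrow> complex) \<Rightarrow> nat \<Rightarrow> complex" where
  "diff_seq g n = g (Suc n) - g n"

text \<open>The value at 0 is left out: \<open>0 powr a\<close> is 0, so a bound there would force
  \<open>g 0 = 0\<close>.\<close>

definition power_bounded :: "real \<Rightarrow> (nat \<Rightarrow> complex) \<Rightarrow> bool" where
  "power_bounded a g \<longleftrightarrow> (\<exists>C\<ge>0. \<forall>n>0. norm (g n) \<le> C * real n powr a)"

text \<open>
  Only the first \<open>j\<close> differences are controlled; keeping \<open>j\<close> finite makes everything an induction
  on \<open>j\<close>, at the price of one difference per summation.
\<close>

primrec symbol_seq :: "nat \<Rightarrow> real \<Rightarrow> (nat \<Rightarrow> complex) \<Rightarrow> bool" where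
  "symbol_seq 0 a g \<longleftrightarrow> power_bounded a g"
| "symbol_seq (Suc j) a g \<longleftrightarrow> power_bounded a g \<and> symbol_seq j (a - 1) (diff_seq g)"

section \<open>Closure properties of symbols\<close>

lemma power_boundedI:
  assumes "\<And>n. n > 0 \<Longrightarrow> norm (g n) \<le> C * real n powr a"
  shows "power_bounded a g"
proof -
  have "norm (g 1) \<le> C" using assms[of 1] by simp
  then have "C \<ge> 0" by (rule order_trans[OF norm_ge_zero])
  with assms show ?thesis by (auto simp: power_bounded_def)
qed

lemma power_boundedE:
  assumes "power_bounded a g"
  obtains C where "C \<ge> 0" "\<And>n. n > 0 \<Longrightarrow> norm (g n) \<le> C * real n powr a"
  using assms by (auto simp: power_bounded_def)

lemma power_bounded_mono:
  assumes "power_bounded a g" "a \<le> b"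
  shows "power_bounded b g"
proof -
  obtain C where C: "C \<ge> 0" "\<And>n. n > 0 \<Longrightarrow> norm (g n) \<le> C * real n powr a"
    using assms(1) by (rule power_boundedE) blast
  show ?thesis
  proof (rule power_boundedI)
    fix n :: nat assume n: "n > 0"
    have "real n powr a \<le> real n powr b" using n assms(2) by (intro powr_mono) auto
    then have "C * real n powr a \<le> C * real n powr b" using C(1) by (rule mult_left_mono)
    then show "norm (g n) \<le> C * real n powr b" using C(2)[OF n] by linarith
  qed
qed

lemma power_bounded_add:
  assumes "power_bounded a g" "power_bounded a h"
  shows "power_bounded a (\<lambda>n. g n + h n)"
proof -
  obtain C where C: "\<And>n. n > 0 \<Longrightarrow> norm (g n) \<le> C * real n powr a"
    using assms(1) by (rule power_boundedE) blast
  obtain D where D: "\<And>n. n > 0 \<Longrightarrow> norm (h n) \<le> D * real n powr a"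
    using assms(2) by (rule power_boundedE) blast
  show ?thesis
  proof (rule power_boundedI)
    fix n :: nat assume "n > 0"
    then show "norm (g n + h n) \<le> (C + D) * real n powr a"
      using C[of n] D[of n] norm_triangle_ineq[of "g n" "h n"] by (simp add: distrib_right)
  qed
qed

lemma power_bounded_mult:
  assumes "power_bounded a g" "power_bounded b h"
  shows "power_bounded (a + b) (\<lambda>n. g n * h n)"
proof -
  obtain C where C: "C \<ge> 0" "\<And>n. n > 0 \<Longrightarrow> norm (g n) \<le> C * real n powr a"
    using assms(1) by (rule power_boundedE) blast
  obtain D where D: "\<And>n. n > 0 \<Longrightarrow> norm (h n) \<le> D * real n powr b"
    using assms(2) by (rule power_boundedE) blast
  show ?thesis
  proof (rule power_boundedI)
    fix n :: nat assume n: "n > 0"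
    have "norm (g n) * norm (h n) \<le> (C * real n powr a) * (D * real n powr b)"
      using C D n by (intro mult_mono) auto
    then show "norm (g n * h n) \<le> C * D * real n powr (a + b)"
      by (simp add: norm_mult powr_add mult_ac)
  qed
qed

lemma symbol_seq_imp_power_bounded: "symbol_seq j a g \<Longrightarrow> power_bounded a g"
  by (cases j) auto

lemma symbol_seq_SucD: "symbol_seq (Suc j) a g \<Longrightarrow> symbol_seq j a g"
  by (induction j arbitrary: a g) auto

lemma symbol_seq_mono: "symbol_seq j a g \<Longrightarrow> a \<le> b \<Longrightarrow> symbol_seq j b g"
proof (induction j arbitrary: a b g)
  case (Suc j)
  then have "symbol_seq j (b - 1) (diff_seq g)" by (auto intro: Suc.IH[of "a - 1"])
  with Suc.prems show ?case by (auto intro: power_bounded_mono)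
qed (auto intro: power_bounded_mono)

lemma symbol_seq_add:
  "symbol_seq j a g \<Longrightarrow> symbol_seq j a h \<Longrightarrow> symbol_seq j a (\<lambda>n. g n + h n)"
proof (induction j arbitrary: a g h)
  case (Suc j)
  have "diff_seq (\<lambda>n. g n + h n) = (\<lambda>n. diff_seq g n + diff_seq h n)"
    by (auto simp: diff_seq_def)
  with Suc show ?case by (auto intro: power_bounded_add)
qed (auto intro: power_bounded_add)

text \<open>Discrete Leibniz rule: the difference of a product has two terms of order
  \<open>a + b - 1\<close> and one of order \<open>a + b - 2\<close>, each a product at the previous
  level.\<close>

lemma symbol_seq_mult:
  "symbol_seq j a g \<Longrightarrow> symbol_seq j b h \<Longrightarrow> symbol_seq j (a + b) (\<lambda>n. g n * h n)"
proof (induction j arbitrary: a b g h)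
  case (Suc j)
  let ?dg = "diff_seq g" and ?dh = "diff_seq h"
  have g: "symbol_seq j a g" "symbol_seq j (a - 1) ?dg"
    using Suc.prems(1) symbol_seq_SucD by auto
  have h: "symbol_seq j b h" "symbol_seq j (b - 1) ?dh"
    using Suc.prems(2) symbol_seq_SucD by auto
  have "symbol_seq j (a - 1 + b) (\<lambda>n. ?dg n * h n)"
    "symbol_seq j (a + (b - 1)) (\<lambda>n. g n * ?dh n)"
    "symbol_seq j ((a - 1) + (b - 1)) (\<lambda>n. ?dg n * ?dh n)"
    using g h by (blast intro: Suc.IH)+
  then have "symbol_seq j (a + b - 1) (\<lambda>n. ?dg n * h n)"
    "symbol_seq j (a + b - 1) (\<lambda>n. g n * ?dh n)"
    "symbol_seq j (a + b - 1) (\<lambda>n. ?dg n * ?dh n)"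
    by (auto elim: symbol_seq_mono)
  then have "symbol_seq j (a + b - 1) (\<lambda>n. ?dg n * h n + g n * ?dh n + ?dg n * ?dh n)"
    by (intro symbol_seq_add)
  moreover have "diff_seq (\<lambda>n. g n * h n) = (\<lambda>n. ?dg n * h n + g n * ?dh n + ?dg n * ?dh n)"
    by (auto simp: diff_seq_def algebra_simps)
  ultimately show ?case using Suc.prems by (auto intro: power_bounded_mult)
qed (auto intro: power_bounded_mult)

lemma symbol_seq_zero: "symbol_seq j a (\<lambda>n. 0)"
proof (induction j arbitrary: a)
  case (Suc j)
  have "diff_seq (\<lambda>n. 0) = (\<lambda>n. 0)" by (auto simp: diff_seq_def)
  with Suc show ?case by (auto intro: power_boundedI[where C = 0])
qed (auto intro: power_boundedI[where C = 0])

lemma symbol_seq_const: "symbol_seq j 0 (\<lambda>n. c)"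
proof (cases j)
  case (Suc k)
  have "diff_seq (\<lambda>n. c) = (\<lambda>n. 0)" by (auto simp: diff_seq_def)
  then show ?thesis
    using Suc by (auto intro: power_boundedI[where C = "norm c"] symbol_seq_zero)
qed (auto intro: power_boundedI[where C = "norm c"])

section \<open>Complex powers as symbols\<close>

lemma powr_unit_interval_le:
  fixes x y a :: real
  assumes "1 \<le> x" "x \<le> y" "y \<le> x + 1"
  shows "y powr a \<le> 2 powr \<bar>a\<bar> * x powr a"
proof -
  \<comment> \<open>The ratio lies in [1, 2]; the absolute value of \<open>a\<close> treats both
    signs at once.\<close>
  have "y / x \<ge> 1" "y / x \<le> 2" using assms by (auto simp: field_simps)
  then have "(y / x) powr a \<le> (y / x) powr \<bar>a\<bar>" "(y / x) powr \<bar>a\<bar> \<le> 2 powr \<bar>a\<bar>"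
    by (auto intro: powr_mono powr_mono2)
  then have "(y / x) powr a \<le> 2 powr \<bar>a\<bar>" by linarith
  then show ?thesis using assms by (simp add: powr_divide field_simps)
qed

text \<open>\<open>F k\<close> is the k-th derivative of \<open>F 0\<close>. Keeping the whole
  family makes the induction close: the differences \<open>F k (x + 1) - F k x\<close> form such a
  family again, with order lowered by one by the mean value inequality.\<close>

lemma symbol_seq_of_derivatives:
  fixes F :: "nat \<Rightarrow> real \<Rightarrow> complex"
  assumes "\<And>k x. x \<ge> 1 \<Longrightarrow> (F k has_vector_derivative F (Suc k) x) (at x)"
    and "\<And>k. \<exists>C. \<forall>x\<ge>1. norm (F k x) \<le> C * x powr (a - real k)"
  shows "symbol_seq j a (\<lambda>n. F 0 (real n))"
  using assms
proof (induction j arbitrary: a F)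
  case 0
  obtain C where "\<forall>x\<ge>1. norm (F 0 x) \<le> C * x powr a" using 0(2)[of 0] by auto
  then show ?case by (auto intro!: power_boundedI[where C = C])
next
  case (Suc j)
  obtain C where "\<forall>x\<ge>1. norm (F 0 x) \<le> C * x powr a" using Suc.prems(2)[of 0] by auto
  then have "power_bounded a (\<lambda>n. F 0 (real n))" by (auto intro!: power_boundedI[where C = C])
  moreover have "symbol_seq j (a - 1) (\<lambda>n. (\<lambda>k x. F k (x + 1) - F k x) 0 (real n))"
  proof (rule Suc.IH)
    fix k and x :: real assume x: "x \<ge> 1"
    have "((\<lambda>x. x + 1) has_vector_derivative 1) (at x)"
      using has_vector_derivative_add_const[of "\<lambda>x. x" 1 1 "at x"] by simp
    from vector_diff_chain_at[OF this Suc.prems(1)[of "x + 1" k]]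
    have "((\<lambda>x. F k (x + 1)) has_vector_derivative F (Suc k) (x + 1)) (at x)"
      using x by (simp add: o_def)
    then show "((\<lambda>x. F k (x + 1) - F k x) has_vector_derivative
        F (Suc k) (x + 1) - F (Suc k) x) (at x)"
      using Suc.prems(1) x by (intro has_vector_derivative_diff) auto
  next
    fix k
    let ?b = "a - 1 - real k"
    obtain C where C: "\<And>x. x \<ge> 1 \<Longrightarrow> norm (F (Suc k) x) \<le> C * x powr ?b"
      using Suc.prems(2)[of "Suc k"] by (auto simp: algebra_simps)
    have "norm (F (Suc k) 1) \<le> C" using C[of 1] by simp
    then have C0: "C \<ge> 0" by (rule order_trans[OF norm_ge_zero])
    have "norm (F k (x + 1) - F k x) \<le> C * 2 powr \<bar>?b\<bar> * x powr ?b" if x: "x \<ge> 1" for x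
    proof -
      have "norm (F k (x + 1) - F k x) \<le> (C * (2 powr \<bar>?b\<bar> * x powr ?b)) * norm (x + 1 - x)"
      proof (rule differentiable_bound[where S = "{x..x + 1}"
            and f' = "\<lambda>y h. h *\<^sub>R F (Suc k) y"])
        fix y assume y: "y \<in> {x..x + 1}"
        show "(F k has_derivative (\<lambda>h. h *\<^sub>R F (Suc k) y)) (at y within {x..x + 1})"
          using Suc.prems(1)[of y k] x y
          by (auto simp: has_vector_derivative_def intro: has_derivative_at_withinI)
        have "norm (F (Suc k) y) \<le> C * y powr ?b" using C x y by auto
        also have "\<dots> \<le> C * (2 powr \<bar>?b\<bar> * x powr ?b)"
          using x y C0 by (intro mult_left_mono powr_unit_interval_le) auto
        finally show "onorm (\<lambda>h. h *\<^sub>R F (Suc k) y) \<le> C * (2 powr \<bar>?b\<bar> * x powr ?b)"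
          by (intro onorm_le) (auto simp: mult.commute intro: mult_left_mono)
      qed auto
      then show ?thesis by (simp add: mult_ac)
    qed
    then show "\<exists>C. \<forall>x\<ge>1. norm (F k (x + 1) - F k x) \<le> C * x powr ?b" by blast
  qed
  moreover have "diff_seq (\<lambda>n. F 0 (real n)) = (\<lambda>n. F 0 (real n + 1) - F 0 (real n))"
    by (auto simp: diff_seq_def add.commute)
  ultimately show ?case by simp
qed

lemma symbol_seq_powr: "symbol_seq j (Re z) (\<lambda>n. of_nat n powr z)"
proof -
  \<comment> \<open>The k-th derivative of x powr z, with a falling factorial in front.\<close>
  define F where "F k x = (\<Prod>i<k. z - of_nat i) * of_real x powr (z - of_nat k)"
    for k and x :: real
  have "symbol_seq j (Re z) (\<lambda>n. F 0 (real n))"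
  proof (rule symbol_seq_of_derivatives)
    fix k and x :: real assume x: "x \<ge> 1"
    have "((\<lambda>w. (\<Prod>i<k. z - of_nat i) * w powr (z - of_nat k)) has_field_derivative F (Suc k) x)
        (at (of_real x))"
      unfolding F_def using x
      by (auto intro!: derivative_eq_intros simp: complex_nonpos_Reals_iff algebra_simps)
    then show "(F k has_vector_derivative F (Suc k) x) (at x)"
      unfolding F_def by (rule has_vector_derivative_real_field)
  next
    fix k
    have "\<forall>x\<ge>1. norm (F k x) \<le> norm (\<Prod>i<k. z - of_nat i) * x powr (Re z - real k)"
      by (auto simp: F_def norm_mult norm_powr_real_powr)
    then show "\<exists>C. \<forall>x\<ge>1. norm (F k x) \<le> C * x powr (Re z - real k)" by blast
  qed
  then show ?thesis by (simp add: F_def)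
qed

section \<open>Summation against coefficients with bounded partial sums\<close>

text \<open>Integral comparison in telescoping form: by the mean value theorem each term is at most
  the drop of \<open>y powr a / (- a)\<close> over the unit interval ending at its base.\<close>

lemma sum_powr_tail_bound:
  fixes a :: real
  assumes "a < 0" "x > 0"
  shows "summable (\<lambda>m. real (x + Suc m) powr (a - 1))"
    and "(\<Sum>m. real (x + Suc m) powr (a - 1)) \<le> real x powr a / (- a)"
proof -
  have step: "real (x + Suc m) powr (a - 1)
      \<le> real (x + m) powr a / (- a) - real (x + Suc m) powr a / (- a)" for m
  proof -
    let ?y = "real (x + m)"
    have "\<exists>w. ?y < w \<and> w < ?y + 1 \<and>
        (?y + 1) powr a - ?y powr a = (?y + 1 - ?y) * (a * w powr (a - 1))"
      using assms by (intro MVT2) (auto intro!: derivative_eq_intros)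
    then obtain w where w: "?y < w" "w < ?y + 1"
      and eq: "(?y + 1) powr a - ?y powr a = a * w powr (a - 1)"
      by auto
    have "(?y + 1) powr (a - 1) \<le> w powr (a - 1)"
      using w assms by (intro powr_mono2') auto
    also have "w powr (a - 1) = ?y powr a / (- a) - (?y + 1) powr a / (- a)"
      using eq assms by (simp add: field_simps)
    finally show ?thesis by (simp add: add_ac)
  qed
  have "(\<lambda>m. real (x + m) powr a / (- a)) \<longlonglongrightarrow> 0"
    using assms by real_asymp
  from telescope_sums'[OF this]
  have sums: "(\<lambda>m. real (x + m) powr a / (- a) - real (x + Suc m) powr a / (- a))
      sums (real x powr a / (- a))"
    by simp
  show *: "summable (\<lambda>m. real (x + Suc m) powr (a - 1))"
    using step by (intro summable_comparison_test'[OF sums_summable[OF sums]]) auto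
  show "(\<Sum>m. real (x + Suc m) powr (a - 1)) \<le> real x powr a / (- a)"
    using suminf_le[OF step * sums_summable[OF sums]] sums_unique[OF sums] by simp
qed

lemma summation_by_parts:
  fixes c h :: "nat \<Rightarrow> 'a::comm_ring"
  shows "(\<Sum>m<N. c m * h m) =
    (\<Sum>m<N. c m) * h N - (\<Sum>m<N. (\<Sum>k<Suc m. c k) * (h (Suc m) - h m))"
  by (induction N) (auto simp: algebra_simps)

text \<open>Index \<open>m\<close> stands for the integer \<open>m + 1\<close>, so
  \<open>c m\<close> will be the character value at \<open>Suc m\<close>.\<close>

definition shifted_sum :: "(nat \<Rightarrow> complex) \<Rightarrow> (nat \<Rightarrow> complex) \<Rightarrow> nat \<Rightarrow> complex" where
  "shifted_sum c g x = (\<Sum>m. c m * g (x + Suc m))"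

text \<open>Abel summation: the boundary term vanishes because a < 0, and what remains converges
  absolutely since \<open>diff_seq g\<close> has order \<open>a - 1 < -1\<close>. Summing that tail
  restores the order \<open>a\<close>.\<close>

lemma shifted_sum_converges:
  assumes a: "a < 0" and g: "symbol_seq 1 a g"
    and B: "\<And>N. norm (\<Sum>m<N. c m) \<le> B"
  shows "summable (\<lambda>m. c m * g (x + Suc m))"
    and "power_bounded a (shifted_sum c g)"
proof -
  have B0: "B \<ge> 0" using B[of 0] by simp
  obtain C where C: "C \<ge> 0" "\<And>n. n > 0 \<Longrightarrow> norm (g n) \<le> C * real n powr a"
    using g by (auto elim: power_boundedE)
  obtain D where D: "D \<ge> 0" "\<And>n. n > 0 \<Longrightarrow> norm (diff_seq g n) \<le> D * real n powr (a - 1)"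
    using g by (auto elim: power_boundedE)
  let ?X = "\<lambda>N. \<Sum>m<N. c m"
  let ?t = "\<lambda>x m. ?X (Suc m) * diff_seq g (x + Suc m)"
  have t_le: "norm (?t x m) \<le> (B * D) * real (x + Suc m) powr (a - 1)" for x m
    using mult_mono[OF B[of "Suc m"] D(2)[of "x + Suc m"]] B0
    by (simp add: norm_mult mult.assoc del: sum.lessThan_Suc)
  \<comment> \<open>This majorant serves all \<open>x\<close>, including the shift
    \<open>x = 0\<close> of the outermost sum, where \<open>sum_powr_tail_bound\<close> does not
    apply.\<close>
  have "summable (\<lambda>m. real (Suc m) powr (a - 1))"
    using a by (subst summable_Suc_iff) (simp add: summable_real_powr_iff)
  then have sm0: "summable (\<lambda>m. (B * D) * real (Suc m) powr (a - 1))"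
    by (rule summable_mult)
  have abs_summable: "summable (\<lambda>m. norm (?t x m))" for x
  proof (rule summable_comparison_test'[OF sm0])
    fix m
    have "(B * D) * real (x + Suc m) powr (a - 1) \<le> (B * D) * real (Suc m) powr (a - 1)"
      using B0 D(1) a by (intro mult_left_mono powr_mono2') auto
    then show "norm (norm (?t x m)) \<le> (B * D) * real (Suc m) powr (a - 1)"
      using order_trans[OF t_le] by simp
  qed
  have sums: "(\<lambda>m. c m * g (x + Suc m)) sums (- (\<Sum>m. ?t x m))" for x
  proof -
    have boundary: "(\<lambda>N. ?X N * g (x + Suc N)) \<longlonglongrightarrow> 0"
    proof (rule Lim_null_comparison[OF always_eventually], rule allI)
      fix N
      show "norm (?X N * g (x + Suc N)) \<le> (B * C) * real (x + Suc N) powr a"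
        using mult_mono[OF B[of N] C(2)[of "x + Suc N"]] B0
        by (simp add: norm_mult mult.assoc)
    next
      show "(\<lambda>N. (B * C) * real (x + Suc N) powr a) \<longlonglongrightarrow> 0"
      proof -
        have "(\<lambda>N. real (x + Suc N) powr a) \<longlonglongrightarrow> 0" using a by real_asymp
        then show ?thesis by (rule tendsto_mult_right_zero)
      qed
    qed
    have "(\<lambda>N. \<Sum>m<N. ?t x m) \<longlonglongrightarrow> (\<Sum>m. ?t x m)"
      by (rule summable_LIMSEQ[OF summable_norm_cancel[OF abs_summable]])
    from tendsto_diff[OF boundary this] show ?thesis
      unfolding sums_def summation_by_parts[of c "\<lambda>m. g (x + Suc m)"]
      by (simp add: diff_seq_def)
  qed
  show "summable (\<lambda>m. c m * g (x + Suc m))" using sums by (rule sums_summable)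
  show "power_bounded a (shifted_sum c g)"
  proof (rule power_boundedI)
    fix x :: nat assume x: "x > 0"
    have "norm (shifted_sum c g x) = norm (\<Sum>m. ?t x m)"
      unfolding shifted_sum_def by (subst sums_unique[OF sums, symmetric]) (rule norm_minus_cancel)
    also have "\<dots> \<le> (\<Sum>m. norm (?t x m))" by (rule summable_norm[OF abs_summable])
    also have "\<dots> \<le> (\<Sum>m. (B * D) * real (x + Suc m) powr (a - 1))"
      by (intro suminf_le t_le abs_summable summable_mult sum_powr_tail_bound a x)
    also have "\<dots> = (B * D) * (\<Sum>m. real (x + Suc m) powr (a - 1))"
      by (intro suminf_mult sum_powr_tail_bound a x)
    also have "\<dots> \<le> (B * D) * (real x powr a / (- a))"
      using B0 D(1) by (intro mult_left_mono sum_powr_tail_bound a x) auto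
    finally show "norm (shifted_sum c g x) \<le> (B * D / (- a)) * real x powr a" by simp
  qed
qed

text \<open>By linearity, differencing in \<open>x\<close> acts on \<open>g\<close> alone, so the
  previous lemma applies to each difference. Its partial summation consumes the one extra
  difference.\<close>

lemma symbol_seq_shifted_sum:
  assumes B: "\<And>N. norm (\<Sum>m<N. c m) \<le> B"
  shows "a < 0 \<Longrightarrow> symbol_seq (Suc j) a g \<Longrightarrow> symbol_seq j a (shifted_sum c g)"
proof (induction j arbitrary: a g)
  case 0
  then show ?case using shifted_sum_converges(2)[OF _ _ B, of a g] by simp
next
  case (Suc j)
  have g: "symbol_seq 1 a g"
    using Suc.prems(2) by (auto dest: symbol_seq_imp_power_bounded)
  have summable: "summable (\<lambda>m. c m * g (x + Suc m))" for x
    by (rule shifted_sum_converges(1)[OF Suc.prems(1) g B])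
  have "diff_seq (shifted_sum c g) = shifted_sum c (diff_seq g)"
  proof
    fix x
    show "diff_seq (shifted_sum c g) x = shifted_sum c (diff_seq g) x"
      using suminf_diff[OF summable[of "Suc x"] summable[of x]]
      by (simp add: diff_seq_def shifted_sum_def algebra_simps)
  qed
  moreover have "symbol_seq j (a - 1) (shifted_sum c (diff_seq g))"
    using Suc.prems by (intro Suc.IH) auto
  moreover have "power_bounded a (shifted_sum c g)"
    by (rule shifted_sum_converges(2)[OF Suc.prems(1) g B])
  ultimately show ?case by simp
qed

section \<open>Character sums\<close>

lemma dirichlet_character_mod:
  assumes "dirichlet_character q chi"
  shows "chi (n mod q) = chi n"
proof -
  have per: "chi (n + q) = chi n" for n using assms by (simp add: dirichlet_character_def)
  have "chi (m + k * q) = chi m" for m k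
  proof (induction k)
    case (Suc k)
    then show ?case using per[of "m + k * q"] by (simp add: algebra_simps)
  qed auto
  from this[of "n mod q" "n div q"] show ?thesis by simp
qed

text \<open>Multiplication by a unit \<open>a\<close> permutes the residues, so the sum equals
  itself times \<open>chi a\<close>; choose \<open>a\<close> with
  \<open>chi a \<noteq> 1\<close>.\<close>

lemma nonprincipal_character_sum_period:
  assumes chi: "dirichlet_character q chi" and np: "chi \<noteq> principal_character q"
  shows "(\<Sum>n<q. chi n) = 0"
proof -
  have q: "q > 0" and mult: "\<And>m n. chi (m * n) = chi m * chi n"
    and nz: "\<And>n. chi n \<noteq> 0 \<longleftrightarrow> coprime n q"
    using chi by (auto simp: dirichlet_character_def)
  \<comment> \<open>Both characters vanish off the units, so they must differ at a unit.\<close>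
  obtain a where a: "coprime a q" "chi a \<noteq> 1"
    using np nz by (auto simp: principal_character_def fun_eq_iff split: if_splits)
  have "inj_on (\<lambda>n. (a * n) mod q) {..<q}"
  proof (rule inj_onI)
    fix m n assume mn: "m \<in> {..<q}" "n \<in> {..<q}" and "(a * m) mod q = (a * n) mod q"
    then have "[a * m = a * n] (mod q)" by (simp add: cong_def)
    then have "[m = n] (mod q)" using a(1) by (simp add: cong_mult_lcancel_nat)
    then show "m = n" using mn by (simp add: cong_def)
  qed
  moreover have "(\<lambda>n. (a * n) mod q) ` {..<q} \<subseteq> {..<q}" using q by auto
  ultimately have bij: "bij_betw (\<lambda>n. (a * n) mod q) {..<q} {..<q}"
    by (simp add: bij_betw_def endo_inj_surj)
  have "(\<Sum>n<q. chi n) = (\<Sum>n<q. chi ((a * n) mod q))"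
    by (rule sum.reindex_bij_betw[OF bij, symmetric])
  also have "\<dots> = chi a * (\<Sum>n<q. chi n)"
    by (simp add: dirichlet_character_mod[OF chi] mult sum_distrib_left)
  finally show ?thesis using a(2) by simp
qed

text \<open>Full periods cancel, leaving less than one period.\<close>

lemma nonprincipal_character_sum_bounded:
  assumes chi: "dirichlet_character q chi" and np: "chi \<noteq> principal_character q"
  obtains B where "\<And>N. norm (\<Sum>m<N. chi (Suc m)) \<le> B"
proof -
  have q: "q > 0" and per: "\<And>n. chi (n + q) = chi n"
    using chi by (auto simp: dirichlet_character_def)
  let ?S = "\<lambda>N. \<Sum>n<N. chi n"
  have S_per: "?S (N + q) = ?S N" for N
    by (induction N) (auto simp: nonprincipal_character_sum_period[OF assms] per)
  have le: "norm (?S N) \<le> (\<Sum>n<q. norm (chi n))" for N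
  proof (induction N rule: less_induct)
    case (less N)
    show ?case
    proof (cases "N < q")
      case True
      have "norm (?S N) \<le> (\<Sum>n<N. norm (chi n))" by (rule norm_sum)
      also have "\<dots> \<le> (\<Sum>n<q. norm (chi n))" using True by (intro sum_mono2) auto
      finally show ?thesis .
    next
      case False
      then show ?thesis using less[of "N - q"] S_per[of "N - q"] q by simp
    qed
  qed
  have "norm (\<Sum>m<N. chi (Suc m)) \<le> (\<Sum>n<q. norm (chi n)) + norm (chi 0)" for N
  proof -
    have "(\<Sum>m<N. chi (Suc m)) = ?S (Suc N) - chi 0"
      by (simp add: sum.lessThan_Suc_shift del: sum.lessThan_Suc)
    also have "norm \<dots> \<le> norm (?S (Suc N)) + norm (chi 0)" by (rule norm_triangle_ineq4)
    also have "\<dots> \<le> (\<Sum>n<q. norm (chi n)) + norm (chi 0)"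
      using le by (rule add_right_mono)
    finally show ?thesis .
  qed
  then show ?thesis by (rule that)
qed

section \<open>The iterated series\<close>

text \<open>Pulls the factor depending on outer variables out of the inner sums. Both claims go
  together because the outer series is formed from the inner values.\<close>

lemma iterated_suminf_cmult:
  "iterated_summable k f \<Longrightarrow>
    iterated_summable k (\<lambda>ns. c * f ns) \<and>
    iterated_suminf k (\<lambda>ns. c * f ns) = c * iterated_suminf k f"
proof (induction k arbitrary: f)
  case (Suc k)
  then show ?case by (auto simp: suminf_mult intro: summable_mult)
qed auto

text \<open>
  Here \<open>x\<close> plays the role of the sum of the variables that are held fixed further outside.
\<close>

definition shifted_L_term ::
  "nat \<Rightarrow> (nat \<Rightarrow> complex) \<Rightarrow> (nat \<Rightarrow> nat \<Rightarrow> complex) \<Rightarrow> nat \<Rightarrow> nat list \<Rightarrow> complex" where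
  "shifted_L_term r s chi x ns =
     (\<Prod>i<r. chi i (ns ! i)) / (\<Prod>i<r. of_nat (x + (\<Sum>j\<le>i. ns ! j)) powr s i)"

text \<open>The outermost variable enters the later denominators only through \<open>x + m\<close>,
  so what is left is a term of the same kind.\<close>

lemma shifted_L_term_Cons:
  "shifted_L_term (Suc r) s chi x (m # ns) =
    chi 0 m * of_nat (x + m) powr (- s 0) *
    shifted_L_term r (\<lambda>i. s (Suc i)) (\<lambda>i. chi (Suc i)) (x + m) ns"
proof -
  have "(\<Sum>j\<le>Suc i. (m # ns) ! j) = m + (\<Sum>j\<le>i. ns ! j)" for i
    by (simp add: sum.atMost_Suc_shift del: sum.atMost_Suc)
  then show ?thesis
    unfolding shifted_L_term_def prod.lessThan_Suc_shift
    by (simp add: powr_minus field_simps del: sum.atMost_Suc)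
qed

text \<open>Convergence alone does not pass through the induction: the next sum needs the inner one
  to be a symbol in the shift. All \<open>j\<close> are carried since each summation costs one
  difference.\<close>

lemma shifted_L_series:
  assumes "\<And>i. i < r \<Longrightarrow> \<exists>B. \<forall>N. norm (\<Sum>m<N. chi i (Suc m)) \<le> B"
    and "\<And>i. i < r \<Longrightarrow> (\<Sum>j = i..<r. Re (s j)) > 0"
  shows "(\<forall>x. iterated_summable r (shifted_L_term r s chi x)) \<and>
    (\<forall>j. symbol_seq j (- (\<Sum>i<r. Re (s i))) (\<lambda>x. iterated_suminf r (shifted_L_term r s chi x)))"
  using assms
proof (induction r arbitrary: s chi)
  case 0
  show ?case using symbol_seq_const[of _ 1] by (simp add: shifted_L_term_def)
next
  case (Suc r)
  let ?t = "shifted_L_term r (\<lambda>i. s (Suc i)) (\<lambda>i. chi (Suc i))"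
  let ?F = "\<lambda>x. iterated_suminf r (?t x)"
  let ?a = "- (\<Sum>i<Suc r. Re (s i))"
  \<comment> \<open>All that depends on the new partial sum \<open>n = x + m\<close>, apart from the
    character value.\<close>
  define g where "g n = of_nat n powr (- s 0) * ?F n" for n
  have IH: "(\<forall>x. iterated_summable r (?t x)) \<and> (\<forall>j. symbol_seq j (- (\<Sum>i<r. Re (s (Suc i)))) ?F)"
  proof (rule Suc.IH)
    fix i assume i: "i < r"
    then show "\<exists>B. \<forall>N. norm (\<Sum>m<N. chi (Suc i) (Suc m)) \<le> B" using Suc.prems(1) by simp
    show "0 < (\<Sum>j = i..<r. Re (s (Suc j)))"
      using Suc.prems(2)[of "Suc i"] i sum.shift_bounds_Suc_ivl[of "\<lambda>j. Re (s j)" i r] by simp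
  qed
  have g: "symbol_seq j ?a g" for j
  proof -
    have "symbol_seq j (Re (- s 0) + - (\<Sum>i<r. Re (s (Suc i)))) g"
      unfolding g_def using IH by (intro symbol_seq_mult symbol_seq_powr) blast
    then show ?thesis unfolding sum.lessThan_Suc_shift by simp
  qed
  \<comment> \<open>The full sum of real parts is the case i = 0 of the hypothesis; the cases i > 0
    went into \<open>IH\<close>.\<close>
  have a: "?a < 0" using Suc.prems(2)[of 0] by (simp add: atLeast0LessThan)
  obtain B where B: "\<And>N. norm (\<Sum>m<N. chi 0 (Suc m)) \<le> B" using Suc.prems(1)[of 0] by auto
  have inner: "iterated_summable r (\<lambda>ns. shifted_L_term (Suc r) s chi x (Suc m # ns))"
    "iterated_suminf r (\<lambda>ns. shifted_L_term (Suc r) s chi x (Suc m # ns)) =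
      chi 0 (Suc m) * g (x + Suc m)" for x m
    using iterated_suminf_cmult[of r "?t (x + Suc m)"
        "chi 0 (Suc m) * of_nat (x + Suc m) powr (- s 0)"] IH
    unfolding shifted_L_term_Cons g_def by (simp_all add: mult_ac)
  have "summable (\<lambda>m. chi 0 (Suc m) * g (x + Suc m))" for x
    by (rule shifted_sum_converges(1)[OF a g B])
  moreover have "symbol_seq j ?a (shifted_sum (\<lambda>m. chi 0 (Suc m)) g)" for j
    by (rule symbol_seq_shifted_sum[OF B a g])
  ultimately show ?case using inner by (simp add: shifted_sum_def[abs_def])
qed

theorem theorem1:
  fixes r :: nat and q :: "nat \<Rightarrow> nat"
    and chi :: "nat \<Rightarrow> nat \<Rightarrow> complex" and s :: "nat \<Rightarrow> complex"
  assumes "r \<ge> 1"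
    and "\<And>i. i < r \<Longrightarrow> dirichlet_character (q i) (chi i)"
    and "\<And>i. i < r \<Longrightarrow> chi i \<noteq> principal_character (q i)"
    and "s \<in> convergence_region r"
  shows "multiple_L_convergent r s chi"
proof -
  have "(\<forall>x. iterated_summable r (shifted_L_term r s chi x)) \<and>
    (\<forall>j. symbol_seq j (- (\<Sum>i<r. Re (s i))) (\<lambda>x. iterated_suminf r (shifted_L_term r s chi x)))"
  proof (rule shifted_L_series)
    fix i assume i: "i < r"
    show "\<exists>B. \<forall>N. norm (\<Sum>m<N. chi i (Suc m)) \<le> B"
      by (rule nonprincipal_character_sum_bounded[OF assms(2,3)[OF i]]) blast
    \<comment> \<open>The region counts summands from the end; taking \<open>r - 1 - i\<close> there
      gives the sum starting at \<open>i\<close>.\<close>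
    have "0 < (\<Sum>j = r - 1 - (r - 1 - i)..r - 1. Re (s j))"
      using assms(4) unfolding convergence_region_def by (blast intro: diff_le_self)
    moreover have "r - 1 - (r - 1 - i) = i" "{i..r - 1} = {i..<r}" using i by auto
    ultimately show "(\<Sum>j = i..<r. Re (s j)) > 0" by simp
  qed
  moreover have "shifted_L_term r s chi 0 = multiple_L_term r s chi"
    by (auto simp: shifted_L_term_def multiple_L_term_def)
  ultimately show ?thesis unfolding multiple_L_convergent_def by metis
qed

end
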